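(* Let $X$ be a random vector in $\mathbb{R}^q$ with distribution $F$, let $x_1,\dots,x_n$ ($n\ge2$) be an iid sample of $X$, and let $\kappa$ be a Mercer kernel on $\mathbb{R}^q$ whose induced distance function $d_\kappa$ takes values in $[0,1)$. Let $\Delta=\mathbb{E}d_\kappa(X,X')$, where $X'$ is an independent copy of $X$, and $\hat\Delta=\binom n2^{-1}\sum_{i<j}d_\kappa(x_i,x_j)$. Then for every $\epsilon>0$, $$\Pr[\hat\Delta-\Delta\ge\epsilon]\le\exp\left(\frac{-n\epsilon^2}{2}\right)\quad\text{and}\quad \Pr[\Delta-\hat\Delta\ge\epsilon]\le\exp\left(\frac{-n\epsilon^2}{2}\right).$$
   Context: A Mercer kernel on $\mathbb{R}^q$ is a continuous, symmetric, positive (semi)definite function $\kappa:\mathbb{R}^q\times\mathbb{R}^q\to\mathbb{R}$; it induces $d_\kappa(x,x')=\sqrt{\kappa(x,x)+\kappa(x',x')-2\kappa(x,x')}$. *)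

theory Defs
  imports "HOL-Probability.Probability"
begin

definition positive_semidefinite_kernel :: "('a \<Rightarrow> 'a \<Rightarrow> real) \<Rightarrow> bool" where
  "positive_semidefinite_kernel \<kappa> \<longleftrightarrow>
     (\<forall>(m::nat) (x :: nat \<Rightarrow> 'a) (c :: nat \<Rightarrow> real).
        0 \<le> (\<Sum>i<m. \<Sum>j<m. c i * c j * \<kappa> (x i) (x j)))"

definition mercer_kernel :: "('a::topological_space \<Rightarrow> 'a \<Rightarrow> real) \<Rightarrow> bool" where
  "mercer_kernel \<kappa> \<longleftrightarrow>
     continuous_on UNIV (\<lambda>(x, y). \<kappa> x y) \<and>
     (\<forall>x y. \<kappa> x y = \<kappa> y x) \<and>
     positive_semidefinite_kernel \<kappa>"

definition kernel_dist :: "('a \<Rightarrow> 'a \<Rightarrow> real) \<Rightarrow> 'a \<Rightarrow> 'a \<Rightarrow> real" where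
  "kernel_dist \<kappa> x y = sqrt (\<kappa> x x + \<kappa> y y - 2 * \<kappa> x y)"

end

theory Submission
  imports Defs "HOL-Combinatorics.Permutations"
begin

text \<open>
  Hoeffding's averaging argument. Fix \<open>k = \<lfloor>n/2\<rfloor>\<close> disjoint pairs of indices. The U-statistic is the
  average, over all permutations \<open>\<sigma>\<close> of the index set, of the mean of the kernel over the \<open>\<sigma>\<close>-images
  of these pairs. Each such mean is an average of \<open>k\<close> independent variables in \<open>[0,1]\<close>, so by
  Hoeffding's lemma and convexity of the exponential the moment generating function of the
  centred U-statistic at \<open>l\<close> is at most \<open>exp (l\<^sup>2 / (8 k))\<close>. Chernoff's bound gives the tail
  \<open>exp (-2 k \<epsilon>\<^sup>2)\<close>, and \<open>2 k \<ge> n/2\<close> for \<open>n \<ge> 2\<close>.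
  The lower tail is the upper tail for the kernel \<open>1 - h\<close>.
\<close>

section \<open>Averages over permutations\<close>

text \<open>Two transpositions suffice: the first sends \<open>a\<close> to \<open>c\<close>, the
  second sends the current image of \<open>b\<close> to \<open>d\<close>.\<close>

lemma permutes_two_points:
  assumes "a \<in> S" "b \<in> S" "c \<in> S" "d \<in> S" "a \<noteq> b" "c \<noteq> d"
  obtains p where "p permutes S" "p a = c" "p b = d"
proof
  let ?q = "Transposition.transpose a c"
  have q: "?q permutes S"
    using assms by (intro permutes_swap_id)
  then have "?q b \<in> S"
    using assms by (simp only: permutes_in_image)
  then show "Transposition.transpose (?q b) d \<circ> ?q permutes S"
    using assms q by (intro permutes_compose permutes_swap_id)
  \<comment> \<open>Together with \<open>c \<noteq> d\<close>, this makes the second transposition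
    fix \<open>c\<close>.\<close>
  have "?q b \<noteq> c"
    using assms by (auto simp: Transposition.transpose_def)
  then show "(Transposition.transpose (?q b) d \<circ> ?q) a = c"
    using assms by (auto simp: Transposition.transpose_def)
  show "(Transposition.transpose (?q b) d \<circ> ?q) b = d"
    by simp
qed

text \<open>Double counting: permutations act transitively on ordered pairs of distinct points, so
  the sum on the left is the same for every pair in \<open>D\<close> and may be averaged over
  \<open>D\<close>.\<close>

lemma sum_permutations_pair:
  fixes g :: "'i \<Rightarrow> 'i \<Rightarrow> real"
  assumes fin: "finite S" and ab: "a \<in> S" "b \<in> S" "a \<noteq> b"
  defines "D \<equiv> SIGMA i:S. S - {i}"
  shows "real (card D) * (\<Sum>p | p permutes S. g (p a) (p b)) = fact (card S) * (\<Sum>(i, j)\<in>D. g i j)"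
proof -
  let ?P = "{p. p permutes S}"
  \<comment> \<open>Composition on the right with a \<open>q\<close> that carries
    \<open>(a, b)\<close> to \<open>(i, j)\<close> only reorders the permutations.\<close>
  have shift: "(\<Sum>p\<in>?P. g (p a) (p b)) = (\<Sum>p\<in>?P. g (p i) (p j))" if "(i, j) \<in> D" for i j
  proof -
    from that have ij: "i \<in> S" "j \<in> S" "i \<noteq> j"
      by (auto simp: D_def)
    obtain q where q: "q permutes S" "q a = i" "q b = j"
      using permutes_two_points[OF ab(1,2) ij(1,2) ab(3) ij(3)] by metis
    show ?thesis
      using sum_permutations_compose_right[OF q(1), of "\<lambda>p. g (p a) (p b)"] q(2,3)
      by simp
  qed
  have perm: "(\<Sum>(i, j)\<in>D. g (p i) (p j)) = (\<Sum>(i, j)\<in>D. g i j)" if p: "p permutes S" for p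
  proof -
    have "bij_betw (map_prod p p) D D"
    proof (rule bij_betw_byWitness[where f' = "map_prod (inv p) (inv p)"])
      show "map_prod p p ` D \<subseteq> D" "map_prod (inv p) (inv p) ` D \<subseteq> D"
        using p permutes_inv[OF p] permutes_inj[OF p] permutes_inj[OF permutes_inv[OF p]]
        by (auto simp: D_def permutes_in_image inj_eq)
    qed (use permutes_inverses[OF p] in auto)
    from sum.reindex_bij_betw[OF this, of "\<lambda>(i, j). g i j"] show ?thesis
      by (simp add: case_prod_unfold)
  qed
  have "real (card D) * (\<Sum>p\<in>?P. g (p a) (p b)) = (\<Sum>(i, j)\<in>D. \<Sum>p\<in>?P. g (p a) (p b))"
    by simp
  also have "\<dots> = (\<Sum>(i, j)\<in>D. \<Sum>p\<in>?P. g (p i) (p j))"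
    by (intro sum.cong refl) (clarify, rule shift)
  also have "\<dots> = (\<Sum>p\<in>?P. \<Sum>(i, j)\<in>D. g (p i) (p j))"
    unfolding case_prod_unfold by (rule sum.swap)
  also have "\<dots> = (\<Sum>p\<in>?P. \<Sum>(i, j)\<in>D. g i j)"
    by (intro sum.cong refl perm) simp
  also have "\<dots> = fact (card S) * (\<Sum>(i, j)\<in>D. g i j)"
    using card_permutations[OF refl fin] by simp
  finally show ?thesis .
qed

section \<open>Independent pairs and moment generating functions\<close>

text \<open>Disjoint blocks of an independent family are independent as tuples, and applying
  \<open>h\<close> to each tuple preserves this.\<close>

lemma (in prob_space) indep_vars_disjoint_pairs:
  assumes indep: "indep_vars (\<lambda>_. S) x I"
    and h: "(\<lambda>(u, v). h u v) \<in> S \<Otimes>\<^sub>M S \<rightarrow>\<^sub>M N"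
    and "\<And>t. t \<in> T \<Longrightarrow> a t \<in> I \<and> b t \<in> I"
    and "disjoint_family_on (\<lambda>t. {a t, b t}) T"
  shows "indep_vars (\<lambda>_. N) (\<lambda>t \<omega>. h (x (a t) \<omega>) (x (b t) \<omega>)) T"
proof -
  have "indep_vars (\<lambda>t. PiM {a t, b t} (\<lambda>_. S)) (\<lambda>t \<omega>. restrict (\<lambda>i. x i \<omega>) {a t, b t}) T"
    using assms by (intro indep_vars_restrict[OF indep]) auto
  then have "indep_vars (\<lambda>_. N) (\<lambda>t \<omega>. (\<lambda>f. h (f (a t)) (f (b t))) (restrict (\<lambda>i. x i \<omega>) {a t, b t})) T"
  proof (rule indep_vars_compose2)
    fix t
    have "(\<lambda>f. (f (a t), f (b t))) \<in> PiM {a t, b t} (\<lambda>_. S) \<rightarrow>\<^sub>M S \<Otimes>\<^sub>M S"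
      by (intro measurable_Pair measurable_component_singleton) auto
    from measurable_compose[OF this h]
    show "(\<lambda>f. h (f (a t)) (f (b t))) \<in> PiM {a t, b t} (\<lambda>_. S) \<rightarrow>\<^sub>M N"
      by simp
  qed
  then show ?thesis by simp
qed

text \<open>Independence factorises the integral. With \<open>k = card T\<close>, Hoeffding's lemma
  at \<open>l / k\<close> bounds each factor by \<open>exp ((l / k)\<^sup>2 / 8)\<close>, and there
  are \<open>k\<close> factors. Nonnegative integrals avoid integrability questions for the
  exponentials.\<close>

lemma (in prob_space) indep_mean_mgf_le:
  fixes Y :: "'t \<Rightarrow> 'a \<Rightarrow> real"
  assumes T: "finite T" "T \<noteq> {}"
    and indep: "indep_vars (\<lambda>_. borel) Y T"
    and bounds: "\<And>t \<omega>. t \<in> T \<Longrightarrow> Y t \<omega> \<in> {0..1}"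
    and mean: "\<And>t. t \<in> T \<Longrightarrow> expectation (Y t) = \<mu>"
    and l: "l > 0"
  shows "(\<integral>\<^sup>+\<omega>. exp (l * ((\<Sum>t\<in>T. Y t \<omega>) / card T - \<mu>)) \<partial>M) \<le> ennreal (exp (l\<^sup>2 / (8 * card T)))"
proof -
  define k where "k = real (card T)"
  have k: "k > 0"
    using T by (simp add: k_def card_gt_0_iff)
  have "(\<integral>\<^sup>+\<omega>. exp (l * ((\<Sum>t\<in>T. Y t \<omega>) / card T - \<mu>)) \<partial>M) =
      (\<integral>\<^sup>+\<omega>. (\<Prod>t\<in>T. ennreal (exp (l / k * (Y t \<omega> - \<mu>)))) \<partial>M)"
  proof (intro nn_integral_cong)
    fix \<omega>
    have "l * ((\<Sum>t\<in>T. Y t \<omega>) / card T - \<mu>) = (\<Sum>t\<in>T. l / k * (Y t \<omega> - \<mu>))"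
      unfolding sum_distrib_left[symmetric] sum_subtractf using k by (simp add: k_def field_simps)
    then show "ennreal (exp (l * ((\<Sum>t\<in>T. Y t \<omega>) / card T - \<mu>))) =
        (\<Prod>t\<in>T. ennreal (exp (l / k * (Y t \<omega> - \<mu>))))"
      using T by (simp add: exp_sum prod_ennreal)
  qed
  also have "\<dots> = (\<Prod>t\<in>T. \<integral>\<^sup>+\<omega>. ennreal (exp (l / k * (Y t \<omega> - \<mu>))) \<partial>M)"
    by (intro indep_vars_nn_integral T indep_vars_compose2[OF indep]) auto
  also have "\<dots> \<le> (\<Prod>t\<in>T. ennreal (exp ((l / k)\<^sup>2 / 8)))"
  proof (intro prod_mono_ennreal)
    fix t assume t: "t \<in> T"
    interpret interval_bounded_random_variable M "Y t" 0 1
      using indep bounds t by unfold_locales (auto simp: indep_vars_def)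
    show "(\<integral>\<^sup>+\<omega>. ennreal (exp (l / k * (Y t \<omega> - \<mu>))) \<partial>M) \<le> ennreal (exp ((l / k)\<^sup>2 / 8))"
      using Hoeffdings_lemma_nn_integral[of "l / k"] l k mean[OF t] by simp
  qed
  also have "\<dots> = ennreal (exp (k * ((l / k)\<^sup>2 / 8)))"
    unfolding k_def exp_of_nat_mult by (simp add: ennreal_power)
  also have "k * ((l / k)\<^sup>2 / 8) = l\<^sup>2 / (8 * card T)"
    using k by (simp add: field_simps power2_eq_square flip: k_def)
  finally show ?thesis .
qed

text \<open>The sum runs over ordered pairs because a permutation can carry a chosen pair to either
  order; this is the form in which \<open>sum_permutations_pair\<close> evaluates the
  average.\<close>

lemma (in prob_space) U_statistic_mgf_le:
  fixes h :: "'c \<Rightarrow> 'c \<Rightarrow> real"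
  assumes I: "finite I" "card I \<ge> 2"
    and indep: "indep_vars (\<lambda>_. S) x I"
    and h: "(\<lambda>(u, v). h u v) \<in> borel_measurable (S \<Otimes>\<^sub>M S)"
    and bounds: "\<And>u v. h u v \<in> {0..1}"
    and mean: "\<And>i j. i \<in> I \<Longrightarrow> j \<in> I \<Longrightarrow> i \<noteq> j \<Longrightarrow> expectation (\<lambda>\<omega>. h (x i \<omega>) (x j \<omega>)) = \<mu>"
    and l: "l > 0"
  defines "D \<equiv> SIGMA i:I. I - {i}"
  shows "(\<integral>\<^sup>+\<omega>. exp (l * ((\<Sum>(i, j)\<in>D. h (x i \<omega>) (x j \<omega>)) / card D - \<mu>)) \<partial>M)
    \<le> ennreal (exp (l\<^sup>2 / (8 * (card I div 2))))"
proof -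
  define n where "n = card I"
  define k where "k = n div 2"
  have k: "k > 0"
    using I by (simp add: k_def n_def)
  obtain e where e: "bij_betw e {..<n} I"
    using ex_bij_betw_nat_finite[OF I(1)] by (auto simp: n_def atLeast0LessThan)
  \<comment> \<open>Consecutive positions in an enumeration of \<open>I\<close> form the pairs; for
    odd \<open>n\<close> the last element is left out.\<close>
  define a b where "a = (\<lambda>t. e (2 * t))" and "b = (\<lambda>t. e (2 * t + 1))"
  have less: "2 * t < n" "2 * t + 1 < n" if "t < k" for t
    using that by (auto simp: k_def)
  have ab: "a t \<in> I" "b t \<in> I" "a t \<noteq> b t" if "t < k" for t
    using less[OF that] bij_betw_apply[OF e] inj_on_eq_iff[OF bij_betw_imp_inj_on[OF e]]
    by (auto simp: a_def b_def)
  have disj: "{a s, b s} \<inter> {a t, b t} = {}" if "s < k" "t < k" "s \<noteq> t" for s t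
  proof -
    have "{2 * s, 2 * s + 1} \<inter> {2 * t, 2 * t + 1} = {}"
      using that(3) by auto
    then have "e ` {2 * s, 2 * s + 1} \<inter> e ` {2 * t, 2 * t + 1} = {}"
      using less that(1,2)
      by (subst inj_on_image_Int[OF bij_betw_imp_inj_on[OF e], symmetric]) auto
    then show ?thesis by (simp add: a_def b_def)
  qed
  let ?P = "{p. p permutes I}"
  have P: "finite ?P" "?P \<noteq> {}" "card ?P = fact n"
    using I finite_permutations card_permutations[OF refl I(1)]
    by (auto simp: n_def intro: exI[of _ id] permutes_id)
  \<comment> \<open>The divisor is written \<open>card {..<k}\<close> to match
    \<open>indep_mean_mgf_le\<close>.\<close>
  define W where "W p \<omega> = (\<Sum>t<k. h (x (p (a t)) \<omega>) (x (p (b t)) \<omega>)) / card {..<k}" for p \<omega>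
  define U where "U \<omega> = (\<Sum>(i, j)\<in>D. h (x i \<omega>) (x j \<omega>)) / card D" for \<omega>
  have "finite D" "D \<noteq> {}"
    using I ab[OF k] by (auto simp: D_def)
  then have D: "card D > 0"
    by (simp add: card_gt_0_iff)

  \<comment> \<open>Injectivity of \<open>p\<close> keeps the moved pairs disjoint.\<close>
  have Y: "indep_vars (\<lambda>_. borel) (\<lambda>t \<omega>. h (x (p (a t)) \<omega>) (x (p (b t)) \<omega>)) {..<k}"
    if p: "p permutes I" for p
  proof (rule indep_vars_disjoint_pairs[OF indep h])
    show "disjoint_family_on (\<lambda>t. {p (a t), p (b t)}) {..<k}"
      using disj permutes_inj[OF p] by (fastforce simp: disjoint_family_on_def inj_eq)
  qed (use ab p in \<open>auto simp: permutes_in_image\<close>)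
  have W_mgf: "(\<integral>\<^sup>+\<omega>. exp (l * (W p \<omega> - \<mu>)) \<partial>M) \<le> ennreal (exp (l\<^sup>2 / (8 * k)))"
    if p: "p permutes I" for p
    using indep_mean_mgf_le[OF _ _ Y[OF p], of \<mu> l] k l bounds ab p permutes_inj[OF p] mean
    by (simp add: W_def lessThan_empty_iff permutes_in_image inj_eq)
  have [measurable]: "W p \<in> borel_measurable M" if "p \<in> ?P" for p
    unfolding W_def using Y that
    by (intro borel_measurable_divide borel_measurable_sum) (auto simp: indep_vars_def)

  \<comment> \<open>For each single \<open>t\<close> the average over permutations is already
    \<open>U \<omega>\<close>, so the mean over \<open>t\<close> leaves it unchanged.\<close>
  have avg: "(\<Sum>p\<in>?P. W p \<omega>) / fact n = U \<omega>" for \<omega>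
  proof -
    have "(\<Sum>p\<in>?P. W p \<omega>) = (\<Sum>t<k. \<Sum>p\<in>?P. h (x (p (a t)) \<omega>) (x (p (b t)) \<omega>)) / k"
      unfolding W_def by (subst sum.swap) (simp add: sum_divide_distrib)
    also have "\<dots> = (\<Sum>t<k. fact n * U \<omega>) / k"
    proof (intro arg_cong2[where f = "(/)"] sum.cong refl)
      fix t assume "t \<in> {..<k}"
      then show "(\<Sum>p\<in>?P. h (x (p (a t)) \<omega>) (x (p (b t)) \<omega>)) = fact n * U \<omega>"
        using sum_permutations_pair[OF I(1) ab[of t], of "\<lambda>i j. h (x i \<omega>) (x j \<omega>)"] D
        by (simp add: U_def D_def n_def field_simps)
    qed
    also have "\<dots> = fact n * U \<omega>"
      using k by simp
    finally show ?thesis by simp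
  qed
  define c :: real where "c = 1 / fact n"
  have c: "c \<ge> 0" "fact n * c = 1"
    by (auto simp: c_def)
  \<comment> \<open>Jensen's inequality with uniform weights \<open>c\<close>. The
    \<open>W p\<close> are in general dependent for different \<open>p\<close>; once the average
    stands outside \<open>exp\<close>, linearity of the integral is enough.\<close>
  have convex: "exp (l * (U \<omega> - \<mu>)) \<le> (\<Sum>p\<in>?P. c * exp (l * (W p \<omega> - \<mu>)))" for \<omega>
  proof -
    have "l * (U \<omega> - \<mu>) = (\<Sum>p\<in>?P. c *\<^sub>R (l * (W p \<omega> - \<mu>)))"
      using P(3) by (simp add: sum_subtractf right_diff_distrib c_def flip: avg sum_distrib_left sum_divide_distrib)
    also have "exp \<dots> \<le> (\<Sum>p\<in>?P. c * exp (l * (W p \<omega> - \<mu>)))"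
      using P c by (intro convex_on_sum[OF _ _ exp_convex]) auto
    finally show ?thesis .
  qed
  have "(\<integral>\<^sup>+\<omega>. exp (l * (U \<omega> - \<mu>)) \<partial>M) \<le> (\<integral>\<^sup>+\<omega>. ennreal (\<Sum>p\<in>?P. c * exp (l * (W p \<omega> - \<mu>))) \<partial>M)"
    by (intro nn_integral_mono ennreal_leI convex)
  also have "\<dots> = (\<integral>\<^sup>+\<omega>. (\<Sum>p\<in>?P. ennreal c * ennreal (exp (l * (W p \<omega> - \<mu>)))) \<partial>M)"
    using c(1) by (intro nn_integral_cong) (simp flip: ennreal_mult)
  also have "\<dots> = (\<Sum>p\<in>?P. ennreal c * (\<integral>\<^sup>+\<omega>. exp (l * (W p \<omega> - \<mu>)) \<partial>M))"
    by (subst nn_integral_sum) (auto intro!: sum.cong nn_integral_cmult)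
  also have "\<dots> \<le> (\<Sum>p\<in>?P. ennreal c * ennreal (exp (l\<^sup>2 / (8 * k))))"
    using W_mgf by (intro sum_mono mult_left_mono) auto
  also have "\<dots> = ennreal (\<Sum>p\<in>?P. c * exp (l\<^sup>2 / (8 * k)))"
    using c(1) by (simp only: ennreal_mult'[symmetric] sum_ennreal mult_nonneg_nonneg exp_ge_zero)
  also have "(\<Sum>p\<in>?P. c * exp (l\<^sup>2 / (8 * k))) = exp (l\<^sup>2 / (8 * k))"
    using P(3) c(2) by (simp flip: mult.assoc)
  finally show ?thesis
    by (simp add: U_def k_def n_def)
qed

section \<open>Tail bound for U-statistics\<close>

theorem (in prob_space) U_statistic_Hoeffding_ge:
  fixes h :: "'c \<Rightarrow> 'c \<Rightarrow> real"
  assumes I: "finite I" "card I \<ge> 2"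
    and indep: "indep_vars (\<lambda>_. S) x I"
    and h: "(\<lambda>(u, v). h u v) \<in> borel_measurable (S \<Otimes>\<^sub>M S)"
    and bounds: "\<And>u v. h u v \<in> {0..1}"
    and mean: "\<And>i j. i \<in> I \<Longrightarrow> j \<in> I \<Longrightarrow> i \<noteq> j \<Longrightarrow> expectation (\<lambda>\<omega>. h (x i \<omega>) (x j \<omega>)) = \<mu>"
    and \<epsilon>: "\<epsilon> > 0"
  defines "D \<equiv> SIGMA i:I. I - {i}"
  shows "prob {\<omega> \<in> space M. (\<Sum>(i, j)\<in>D. h (x i \<omega>) (x j \<omega>)) / card D - \<mu> \<ge> \<epsilon>}
    \<le> exp (- 2 * real (card I div 2) * \<epsilon>\<^sup>2)"
proof -
  define k where "k = card I div 2"
  define U where "U \<omega> = (\<Sum>(i, j)\<in>D. h (x i \<omega>) (x j \<omega>)) / card D" for \<omega>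
  \<comment> \<open>This value minimises the Chernoff exponent
    \<open>- l * \<epsilon> + l\<^sup>2 / (8 * k)\<close>; the minimum is
    \<open>- 2 * k * \<epsilon>\<^sup>2\<close>.\<close>
  define l where "l = 4 * real k * \<epsilon>"
  have k: "k > 0"
    using I by (simp add: k_def)
  then have l: "l > 0"
    using \<epsilon> by (simp add: l_def)
  have "(\<lambda>\<omega>. h (x i \<omega>) (x j \<omega>)) \<in> borel_measurable M" if "(i, j) \<in> D" for i j
    using measurable_compose[OF measurable_Pair h, of "x i" M "x j"] indep that
    by (auto simp: indep_vars_def D_def)
  then have [measurable]: "U \<in> borel_measurable M"
    unfolding U_def by (intro borel_measurable_divide borel_measurable_sum) auto
  have "ennreal (prob {\<omega> \<in> space M. U \<omega> - \<mu> \<ge> \<epsilon>})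
      \<le> ennreal (exp (- l * \<epsilon>)) * (\<integral>\<^sup>+\<omega>\<in>space M. exp (l * (U \<omega> - \<mu>)) \<partial>M)"
    unfolding emeasure_eq_measure[symmetric] by (intro Chernoff_ineq_nn_integral_ge l) auto
  also have "(\<integral>\<^sup>+\<omega>\<in>space M. exp (l * (U \<omega> - \<mu>)) \<partial>M) = (\<integral>\<^sup>+\<omega>. exp (l * (U \<omega> - \<mu>)) \<partial>M)"
    by (intro nn_integral_cong) simp
  also have "\<dots> \<le> ennreal (exp (l\<^sup>2 / (8 * k)))"
    using U_statistic_mgf_le[OF I indep h bounds mean l] by (simp add: U_def D_def k_def)
  finally have "prob {\<omega> \<in> space M. U \<omega> - \<mu> \<ge> \<epsilon>} \<le> exp (- l * \<epsilon>) * exp (l\<^sup>2 / (8 * k))"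
    by (simp add: mult_left_mono flip: ennreal_mult)
  also have "\<dots> = exp (- 2 * real k * \<epsilon>\<^sup>2)"
    using k unfolding exp_add[symmetric] l_def by (simp add: field_simps power2_eq_square)
  finally show ?thesis
    by (simp add: U_def k_def)
qed

section \<open>Kernel distances at pairs of sample points\<close>

text \<open>Swapping coordinates exchanges the two sides of the diagonal. This links the ordered
  pairs of the U-statistic bound to the sum over \<open>i < j\<close> in the estimator.\<close>

lemma sum_offdiag_symmetric:
  fixes g :: "'i::linorder \<Rightarrow> 'i \<Rightarrow> real"
  assumes "finite I" "\<And>i j. g i j = g j i"
  shows "(\<Sum>(i, j)\<in>(SIGMA i:I. I - {i}). g i j) = 2 * (\<Sum>(i, j)\<in>{(i, j). i \<in> I \<and> j \<in> I \<and> i < j}. g i j)"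
proof -
  let ?L = "{(i, j). i \<in> I \<and> j \<in> I \<and> i < j}" and ?G = "{(i, j). i \<in> I \<and> j \<in> I \<and> j < i}"
  have fin: "finite ?L" "finite ?G"
    using assms(1) by (auto intro: finite_subset[of _ "I \<times> I"])
  have "(\<Sum>(i, j)\<in>?G. g i j) = (\<Sum>(i, j)\<in>?L. g i j)"
    using assms(2) by (intro sum.reindex_bij_witness[of _ prod.swap prod.swap]) auto
  moreover have "(SIGMA i:I. I - {i}) = ?L \<union> ?G"
    by auto
  moreover have "(\<Sum>(i, j)\<in>?L \<union> ?G. g i j) = (\<Sum>(i, j)\<in>?L. g i j) + (\<Sum>(i, j)\<in>?G. g i j)"
    using fin by (intro sum.union_disjoint) auto
  ultimately show ?thesis by simp
qed

text \<open>The distance inherits continuity from the kernel, and second countability identifies the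
  product of the Borel sigma-algebras with the Borel sigma-algebra of the product.\<close>

lemma borel_measurable_kernel_dist:
  fixes \<kappa> :: "'c::second_countable_topology \<Rightarrow> 'c \<Rightarrow> real"
  assumes "mercer_kernel \<kappa>"
  shows "(\<lambda>(u, v). kernel_dist \<kappa> u v) \<in> borel_measurable (borel \<Otimes>\<^sub>M borel)"
proof -
  have cont: "continuous_on UNIV (\<lambda>(u, v). \<kappa> u v)"
    using assms by (simp add: mercer_kernel_def)
  have [continuous_intros]: "continuous_on UNIV (\<lambda>z. \<kappa> (f z) (g z))"
    if "continuous_on UNIV f" "continuous_on UNIV g" for f g :: "'c \<times> 'c \<Rightarrow> 'c"
    using continuous_on_compose2[OF cont continuous_on_Pair[OF that]] by simp
  have "continuous_on UNIV (\<lambda>(u, v). kernel_dist \<kappa> u v)"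
    unfolding kernel_dist_def case_prod_unfold by (intro continuous_intros)
  then show ?thesis
    unfolding borel_prod by (rule borel_measurable_continuous_onI)
qed

lemma (in prob_space) indep_var_pair:
  assumes "indep_vars (\<lambda>_. S) x I" "i \<in> I" "j \<in> I" "i \<noteq> j"
  shows "indep_var S (x i) S (x j)"
proof -
  have "indep_var (PiM {i} (\<lambda>_. S)) (\<lambda>\<omega>. restrict (\<lambda>i. x i \<omega>) {i})
      (PiM {j} (\<lambda>_. S)) (\<lambda>\<omega>. restrict (\<lambda>i. x i \<omega>) {j})"
    using assms by (intro indep_var_restrict[OF assms(1)]) auto
  then have "indep_var S ((\<lambda>f. f i) \<circ> (\<lambda>\<omega>. restrict (\<lambda>i. x i \<omega>) {i}))
      S ((\<lambda>f. f j) \<circ> (\<lambda>\<omega>. restrict (\<lambda>i. x i \<omega>) {j}))"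
    by (rule indep_var_compose) (auto intro: measurable_component_singleton)
  then show ?thesis by (simp add: comp_def)
qed

text \<open>The joint law is the product of the marginals, so the expectation depends on these
  alone. Pairs living on different probability spaces can thus be compared.\<close>

lemma (in prob_space) expectation_indep_pair:
  fixes f :: "'c \<Rightarrow> 'c \<Rightarrow> real"
  assumes indep: "indep_var S X T Y"
    and f: "(\<lambda>(u, v). f u v) \<in> borel_measurable (S \<Otimes>\<^sub>M T)"
  shows "expectation (\<lambda>\<omega>. f (X \<omega>) (Y \<omega>)) = (\<integral>(u, v). f u v \<partial>(distr M S X \<Otimes>\<^sub>M distr M T Y))"
proof -
  have "distr M S X \<Otimes>\<^sub>M distr M T Y = distr M (S \<Otimes>\<^sub>M T) (\<lambda>\<omega>. (X \<omega>, Y \<omega>))"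
    "(\<lambda>\<omega>. (X \<omega>, Y \<omega>)) \<in> M \<rightarrow>\<^sub>M S \<Otimes>\<^sub>M T"
    using indep by (auto simp: indep_var_distribution_eq)
  then show ?thesis
    using f by (simp add: integral_distr)
qed

section \<open>Both tails for the mean kernel distance\<close>

theorem theorem5:
  fixes N :: "'a measure" and X X' :: "'a \<Rightarrow> real ^ 'q"
    and M :: "'b measure" and x :: "nat \<Rightarrow> 'b \<Rightarrow> real ^ 'q"
    and F :: "(real ^ 'q) measure"
    and \<kappa> :: "real ^ 'q \<Rightarrow> real ^ 'q \<Rightarrow> real"
    and n :: nat and \<Delta> :: real and \<Delta>hat :: "'b \<Rightarrow> real" and \<epsilon> :: real
  assumes "prob_space N" and "prob_space M"
    and "X \<in> borel_measurable N" and "distr N borel X = F"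
    and "X' \<in> borel_measurable N" and "distr N borel X' = F"
    and "prob_space.indep_var N borel X borel X'"
    and "n \<ge> 2"
    and "\<And>i. i \<in> {1..n} \<Longrightarrow> x i \<in> borel_measurable M"
    and "\<And>i. i \<in> {1..n} \<Longrightarrow> distr M borel (x i) = F"
    and "prob_space.indep_vars M (\<lambda>_. borel) x {1..n}"
    and "mercer_kernel \<kappa>"
    and "\<And>u v. kernel_dist \<kappa> u v \<in> {0..<1}"
    and "\<Delta> = (\<integral>\<omega>. kernel_dist \<kappa> (X \<omega>) (X' \<omega>) \<partial>N)"
    and "\<And>\<omega>. \<Delta>hat \<omega> =
           inverse (real (n choose 2)) *
           (\<Sum>(i, j) \<in> {(i, j). 1 \<le> i \<and> i < j \<and> j \<le> n}. kernel_dist \<kappa> (x i \<omega>) (x j \<omega>))"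
    and "\<epsilon> > 0"
  shows "measure M {\<omega> \<in> space M. \<Delta>hat \<omega> - \<Delta> \<ge> \<epsilon>} \<le> exp (- real n * \<epsilon>\<^sup>2 / 2)
       \<and> measure M {\<omega> \<in> space M. \<Delta> - \<Delta>hat \<omega> \<ge> \<epsilon>} \<le> exp (- real n * \<epsilon>\<^sup>2 / 2)"
proof -
  note iid = assms(10,11) and \<Delta>hat = assms(15)
  interpret N: prob_space N by fact
  interpret M: prob_space M by fact
  let ?h = "kernel_dist \<kappa>" and ?I = "{1..n}"
  define D where "D = (SIGMA i:?I. ?I - {i})"
  have h: "(\<lambda>(u, v). ?h u v) \<in> borel_measurable (borel \<Otimes>\<^sub>M borel)"
    by (intro borel_measurable_kernel_dist assms)
  have bounds: "?h u v \<in> {0..1}" for u v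
    using assms(13)[of u v] by auto
  have sym: "?h u v = ?h v u" for u v
    using \<open>mercer_kernel \<kappa>\<close> by (simp add: mercer_kernel_def kernel_dist_def)
  have rv: "x i \<in> borel_measurable M" if "i \<in> ?I" for i
    by (intro assms that)
  \<comment> \<open>Both \<open>(x i, x j)\<close> and \<open>(X, X')\<close> have the law
    \<open>F \<Otimes>\<^sub>M F\<close>.\<close>
  have mean: "M.expectation (\<lambda>\<omega>. ?h (x i \<omega>) (x j \<omega>)) = \<Delta>"
    if ij: "i \<in> ?I" "j \<in> ?I" "i \<noteq> j" for i j
  proof -
    have "M.indep_var borel (x i) borel (x j)"
      using ij by (intro M.indep_var_pair[OF iid(2)]) auto
    from M.expectation_indep_pair[OF this h] show ?thesis
      using N.expectation_indep_pair[OF \<open>N.indep_var borel X borel X'\<close> h] assms(4,6,14) iid(1) ij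
      by simp
  qed
  have mean': "M.expectation (\<lambda>\<omega>. 1 - ?h (x i \<omega>) (x j \<omega>)) = 1 - \<Delta>"
    if ij: "i \<in> ?I" "j \<in> ?I" "i \<noteq> j" for i j
  proof -
    have "(\<lambda>\<omega>. ?h (x i \<omega>) (x j \<omega>)) \<in> borel_measurable M"
      using measurable_compose[OF measurable_Pair h, of "x i" M "x j"] rv ij by simp
    then have "integrable M (\<lambda>\<omega>. ?h (x i \<omega>) (x j \<omega>))"
      using bounds by (intro M.integrable_const_bound[of _ 1]) auto
    then show ?thesis
      using mean[OF ij] by (simp add: M.prob_space)
  qed
  have card_D: "real (card D) = 2 * real (n choose 2)"
  proof -
    \<comment> \<open>The division by 2 in \<open>choose_two\<close> is integer division, so
      evenness is what makes it exact.\<close>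
    have "even (n * (n - 1))"
      by (cases n) auto
    then have "card D = 2 * (n choose 2)"
      unfolding D_def choose_two by (subst card_SigmaI) auto
    then show ?thesis by simp
  qed
  have pos: "real (n choose 2) > 0"
    using \<open>n \<ge> 2\<close> by (simp add: zero_less_binomial_iff)
  have U: "(\<Sum>(i, j)\<in>D. ?h (x i \<omega>) (x j \<omega>)) / card D = \<Delta>hat \<omega>" for \<omega>
  proof -
    have pairs: "{(i, j). i \<in> ?I \<and> j \<in> ?I \<and> i < j} = {(i, j). 1 \<le> i \<and> i < j \<and> j \<le> n}"
      by auto
    have sum: "(\<Sum>(i, j)\<in>D. ?h (x i \<omega>) (x j \<omega>)) =
        2 * (\<Sum>(i, j)\<in>{(i, j). i \<in> ?I \<and> j \<in> ?I \<and> i < j}. ?h (x i \<omega>) (x j \<omega>))"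
      unfolding D_def by (rule sum_offdiag_symmetric[OF _ sym]) simp
    have cancel: "2 * s / (2 * c) = inverse c * s" for s c :: real
      by (simp add: field_simps)
    show ?thesis
      unfolding card_D sum pairs cancel by (rule \<Delta>hat[symmetric])
  qed
  have U': "(\<Sum>(i, j)\<in>D. 1 - ?h (x i \<omega>) (x j \<omega>)) / card D = 1 - \<Delta>hat \<omega>" for \<omega>
    using pos card_D by (simp add: sum_subtractf case_prod_unfold diff_divide_distrib flip: U)
  \<comment> \<open>Rounding loses at most one half: \<open>4 * (n div 2)\<close> is at least
    \<open>2 * n - 2\<close>, hence at least \<open>n\<close> once \<open>n \<ge> 2\<close>.\<close>
  have "real n \<le> 4 * real (n div 2)"
    using \<open>n \<ge> 2\<close> by linarith
  then have "real n * \<epsilon>\<^sup>2 \<le> 4 * real (n div 2) * \<epsilon>\<^sup>2"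
    by (rule mult_right_mono) simp
  then have bound: "exp (- 2 * real (n div 2) * \<epsilon>\<^sup>2) \<le> exp (- real n * \<epsilon>\<^sup>2 / 2)"
    by simp
  have "measure M {\<omega> \<in> space M. \<Delta>hat \<omega> - \<Delta> \<ge> \<epsilon>} \<le> exp (- 2 * real (n div 2) * \<epsilon>\<^sup>2)"
    using M.U_statistic_Hoeffding_ge[OF _ _ iid(2) h bounds mean \<open>\<epsilon> > 0\<close>, folded D_def, unfolded U] \<open>n \<ge> 2\<close>
    by simp
  \<comment> \<open>For the complementary kernel the deviation is
    \<open>(1 - \<Delta>hat \<omega>) - (1 - \<Delta>)\<close>, which equals
    \<open>\<Delta> - \<Delta>hat \<omega>\<close>.\<close>
  moreover have "measure M {\<omega> \<in> space M. \<Delta> - \<Delta>hat \<omega> \<ge> \<epsilon>} \<le> exp (- 2 * real (n div 2) * \<epsilon>\<^sup>2)"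
  proof -
    have h': "(\<lambda>(u, v). 1 - ?h u v) \<in> borel_measurable (borel \<Otimes>\<^sub>M borel)"
      using h by (simp add: case_prod_unfold)
    show ?thesis
      using M.U_statistic_Hoeffding_ge[OF _ _ iid(2) h' _ mean' \<open>\<epsilon> > 0\<close>, folded D_def, unfolded U']
        \<open>n \<ge> 2\<close> bounds
      by simp
  qed
  ultimately show ?thesis
    using bound by linarith
qed

end
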